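(* Every type B generalized permutahedron in $\mathbb R^d$ can be written uniquely as a signed Minkowski sum of the simplices $\Delta_S$ and $\Delta^0_S$, where $S$ ranges over the special involution-exclusive subsets of $[\pm d]$.
   Context: $[\pm d]=\{\pm1,\dots,\pm d\}$. A subset $S\subseteq[\pm d]$ is involution-exclusive if $S\cap(-S)=\emptyset$, and special if moreover it is nonempty and $\min\{|i|:i\in S\}\in S$. Set $e_{-i}=-e_i$ for $i\in[d]$, and $\Delta_S=\mathrm{Conv}\{e_i:i\in S\}$, $\Delta^0_S=\mathrm{Conv}(\{0\}\cup\{e_i:i\in S\})$. A type B generalized permutahedron is a polytope whose normal fan is coarsened by the normal fan of $\pi^B_d$, the convex hull of all signed permutations of $(1,\dots,d)$. A polytope $\mathfrak p$ is a signed Minkowski sum $\sum_Q y_Q\,Q$ of polytopes $Q$ with real coefficients $y_Q$ if $\mathfrak p+\sum_{y_Q<0}|y_Q|\,Q=\sum_{y_Q>0}y_Q\,Q$ (Minkowski sums and dilations); uniqueness refers to the coefficients $y_Q$. *)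

theory Defs
  imports "HOL-Analysis.Analysis" "HOL-Library.Set_Algebras" "HOL-Library.FuncSet"
    "HOL-Combinatorics.Permutations"
begin

text \<open>
  The space \<open>\<real>\<^sup>d\<close> is \<^typ>\<open>real ^ 'n\<close>, where \<open>idx :: nat \<Rightarrow> 'n\<close> is a bijection from \<open>{1..d}\<close> onto
  the coordinates; the statement is made for every such labelling.
\<close>

definition signed_indices :: "nat \<Rightarrow> int set" where
  "signed_indices d = {i. 1 \<le> \<bar>i\<bar> \<and> \<bar>i\<bar> \<le> int d}"

definition involution_exclusive :: "nat \<Rightarrow> int set \<Rightarrow> bool" where
  "involution_exclusive d S \<longleftrightarrow> S \<subseteq> signed_indices d \<and> S \<inter> uminus ` S = {}"

definition special :: "nat \<Rightarrow> int set \<Rightarrow> bool" where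
  "special d S \<longleftrightarrow> involution_exclusive d S \<and> S \<noteq> {} \<and> Min (abs ` S) \<in> S"

definition signed_unit :: "(nat \<Rightarrow> 'n::finite) \<Rightarrow> int \<Rightarrow> real ^ 'n" where
  "signed_unit idx i = real_of_int (sgn i) *\<^sub>R axis (idx (nat \<bar>i\<bar>)) 1"

definition Simplex :: "(nat \<Rightarrow> 'n::finite) \<Rightarrow> int set \<Rightarrow> (real ^ 'n) set" where
  "Simplex idx S = convex hull (signed_unit idx ` S)"

definition Simplex0 :: "(nat \<Rightarrow> 'n::finite) \<Rightarrow> int set \<Rightarrow> (real ^ 'n) set" where
  "Simplex0 idx S = convex hull ({0} \<union> signed_unit idx ` S)"

definition special_simplices :: "nat \<Rightarrow> (nat \<Rightarrow> 'n::finite) \<Rightarrow> (real ^ 'n) set set" where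
  "special_simplices d idx = Simplex idx ` {S. special d S} \<union> Simplex0 idx ` {S. special d S}"

definition normal_cone :: "'a::euclidean_space set \<Rightarrow> 'a set \<Rightarrow> 'a set" where
  "normal_cone P F = {w. \<forall>x\<in>F. \<forall>y\<in>P. w \<bullet> y \<le> w \<bullet> x}"

definition normal_fan :: "'a::euclidean_space set \<Rightarrow> 'a set set" where
  "normal_fan P = {normal_cone P F |F. F face_of P \<and> F \<noteq> {}}"

definition fan_coarsens :: "'a set set \<Rightarrow> 'a set set \<Rightarrow> bool" where
  "fan_coarsens \<G> \<F> \<longleftrightarrow> \<Union>\<G> = \<Union>\<F> \<and> (\<forall>C\<in>\<F>. \<exists>D\<in>\<G>. C \<subseteq> D)"

definition signed_permutations :: "nat \<Rightarrow> (nat \<Rightarrow> 'n::finite) \<Rightarrow> (real ^ 'n) set" where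
  "signed_permutations d idx =
     {x. \<exists>\<sigma> \<epsilon>. \<sigma> permutes {1..d} \<and> (\<forall>i\<in>{1..d}. \<epsilon> i \<in> {1, -1}) \<and>
              (\<forall>i\<in>{1..d}. x $ idx i = \<epsilon> i * real (\<sigma> i))}"

definition permutahedron_B :: "nat \<Rightarrow> (nat \<Rightarrow> 'n::finite) \<Rightarrow> (real ^ 'n) set" where
  "permutahedron_B d idx = convex hull (signed_permutations d idx)"

text \<open>The library's \<^const>\<open>polytope\<close> admits the empty set, which is excluded here.\<close>

definition gen_permutahedron_B :: "nat \<Rightarrow> (nat \<Rightarrow> 'n::finite) \<Rightarrow> (real ^ 'n) set \<Rightarrow> bool" where
  "gen_permutahedron_B d idx P \<longleftrightarrow>
     polytope P \<and> P \<noteq> {} \<and> fan_coarsens (normal_fan P) (normal_fan (permutahedron_B d idx))"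

text \<open>Here \<open>+\<close> and \<open>\<Sum>\<close> on sets are Minkowski sums, with the empty sum equal to \<open>{0}\<close>.\<close>

definition signed_Minkowski_sum ::
  "'a::real_vector set \<Rightarrow> 'a set set \<Rightarrow> ('a set \<Rightarrow> real) \<Rightarrow> bool" where
  "signed_Minkowski_sum P \<Q> y \<longleftrightarrow> finite \<Q> \<and>
     P + (\<Sum>Q\<in>{Q\<in>\<Q>. y Q < 0}. (*\<^sub>R) \<bar>y Q\<bar> ` Q) = (\<Sum>Q\<in>{Q\<in>\<Q>. y Q > 0}. (*\<^sub>R) (y Q) ` Q)"

end

theory Submission imports Defs begin

text \<open>
  A signed Minkowski decomposition of a convex body is the same as an identity between support
  functions. The support functions of type B generalized permutahedra and of the simplices are linear
  on the cones of the type B fan, hence determined by their values on the rays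
  \<open>e\<^sub>T = \<Sum>i\<in>T. e\<^sub>i\<close>, where \<open>T\<close> is a nonempty involution-exclusive set. At \<open>e\<^sub>T\<close> the support
  function of \<open>\<Delta>\<^sub>S\<close> is \<open>[S \<inter> T \<noteq> {}] - [-S \<subseteq> T]\<close> and that of \<open>\<Delta>\<^sup>0\<^sub>S\<close> is \<open>[S \<inter> T \<noteq> {}]\<close>.

  Every function of \<open>T\<close> is a unique combination of the functions \<open>[R \<subseteq> T]\<close>, and
  \<open>[S \<inter> T \<noteq> {}]\<close> is an alternating sum of those with \<open>R \<subseteq> S\<close>. If \<open>R\<close> is special then \<open>-R\<close> is not, so the
  coefficients at special \<open>R\<close> involve only the functions \<open>[S \<inter> T \<noteq> {}]\<close> and form a triangular system;
  the coefficient at \<open>R = -S\<close> then determines the multiplicity of \<open>[-S \<subseteq> T]\<close>.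
\<close>

section \<open>Triangular systems\<close>

text \<open>Elements enter in order of increasing \<open>r\<close>. The newest one, having maximal
  rank, occurs in no earlier equation, and its own equation contains its unknown with coefficient 1
  beside unknowns already fixed. Keeping the relation \<open>le\<close> abstract covers inclusion in
  both directions.\<close>

lemma triangular_system_ex1:
  fixes F :: "'a \<Rightarrow> real" and r :: "'a \<Rightarrow> real" and le :: "'a \<Rightarrow> 'a \<Rightarrow> bool"
  assumes "finite X"
    and "\<And>x. x \<in> X \<Longrightarrow> le x x"
    and "\<And>x y. x \<in> X \<Longrightarrow> y \<in> X \<Longrightarrow> le y x \<Longrightarrow> y \<noteq> x \<Longrightarrow> r y < r x"
  shows "\<exists>!c. c \<in> extensional X \<and> (\<forall>x\<in>X. (\<Sum>y | y \<in> X \<and> le y x. c y) = F x)"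
  using assms
proof (induction X rule: finite_ranking_induct[where f = r])
  case empty
  show ?case by auto
next
  case (insert x X)
  have IH: "\<exists>!c. c \<in> extensional X \<and> (\<forall>x\<in>X. (\<Sum>y | y \<in> X \<and> le y x. c y) = F x)"
    by (rule insert.IH) (use insert.prems in auto)
  show ?case
  \<comment> \<open>The ranking induction does not guarantee that \<open>x\<close> is new.\<close>
  proof (cases "x \<in> X")
    case True
    then show ?thesis using IH by (simp add: insert_absorb)
  next
    case False
    \<comment> \<open>For \<open>z\<close> other than \<open>x\<close>, \<open>le x z\<close> would
      force \<open>r x < r z\<close>, against the maximality of \<open>r x\<close>.\<close>
    have old: "{y. y \<in> insert x X \<and> le y z} = {y. y \<in> X \<and> le y z}" if "z \<in> X" for z
      using insert.hyps(2)[OF that] insert.prems(2)[of z x] that False by force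
    have new: "{y. y \<in> insert x X \<and> le y x} = insert x {y. y \<in> X \<and> le y x}"
      using insert.prems(1) by auto
    have split: "(\<Sum>y | y \<in> insert x X \<and> le y x. c y) = c x + (\<Sum>y | y \<in> X \<and> le y x. c y)"
      for c :: "'a \<Rightarrow> real"
      unfolding new using insert.hyps False by (subst sum.insert) auto
    obtain c where c: "c \<in> extensional X" "\<And>z. z \<in> X \<Longrightarrow> (\<Sum>y | y \<in> X \<and> le y z. c y) = F z"
      and uniq: "\<And>c'. c' \<in> extensional X \<Longrightarrow> (\<forall>z\<in>X. (\<Sum>y | y \<in> X \<and> le y z. c' y) = F z) \<Longrightarrow> c' = c"
      using IH by (auto elim!: ex1E)
    define v where "v = F x - (\<Sum>y | y \<in> X \<and> le y x. c y)"
    have upd: "(\<Sum>y | y \<in> X \<and> le y z. (c(x := v)) y) = (\<Sum>y | y \<in> X \<and> le y z. c y)" for z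
      using False by (intro sum.cong) auto
    show ?thesis
    proof (rule ex1I[of _ "c(x := v)"], intro conjI ballI)
      show "c(x := v) \<in> extensional (insert x X)"
        using c(1) by (auto simp: extensional_def)
      fix z assume z: "z \<in> insert x X"
      show "(\<Sum>y | y \<in> insert x X \<and> le y z. (c(x := v)) y) = F z"
      proof (cases "z = x")
        case True
        then show ?thesis unfolding True split upd by (simp add: v_def)
      next
        case ne: False
        then have "z \<in> X" using z by auto
        then show ?thesis unfolding old[OF \<open>z \<in> X\<close>] upd using c(2) by auto
      qed
    next
      fix c' assume *: "c' \<in> extensional (insert x X) \<and>
        (\<forall>z\<in>insert x X. (\<Sum>y | y \<in> insert x X \<and> le y z. c' y) = F z)"
      have r: "restrict c' X = c"
      proof (rule uniq)
        show "\<forall>z\<in>X. (\<Sum>y | y \<in> X \<and> le y z. restrict c' X y) = F z"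
        proof
          fix z assume z: "z \<in> X"
          have "(\<Sum>y | y \<in> X \<and> le y z. restrict c' X y) = (\<Sum>y | y \<in> X \<and> le y z. c' y)"
            by (intro sum.cong) auto
          then show "(\<Sum>y | y \<in> X \<and> le y z. restrict c' X y) = F z"
            using * old[OF z] z by auto
        qed
      qed auto
      have cX: "c' y = c y" if "y \<in> X" for y
        using that r by auto
      have "c' x = v"
      proof -
        have "c' x + (\<Sum>y | y \<in> X \<and> le y x. c' y) = F x"
          using * split[of c'] by auto
        moreover have "(\<Sum>y | y \<in> X \<and> le y x. c' y) = (\<Sum>y | y \<in> X \<and> le y x. c y)"
          using cX by (intro sum.cong) auto
        ultimately show ?thesis by (simp add: v_def)
      qed
      moreover have "c' y = c y" if "y \<noteq> x" for y
        using that cX[of y] extensional_arb[OF conjunct1[OF *], of y] extensional_arb[OF c(1), of y]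
        by (cases "y \<in> X") auto
      ultimately show "c' = c(x := v)" by auto
    qed
  qed
qed

text \<open>The restrictions of \<open>g\<close> and of the zero function to \<open>X\<close> are
  two extensional solutions, so uniqueness identifies them. This makes uniqueness usable for a
  \<open>g\<close> that is not extensional.\<close>

lemma ex1_zero_system_solution:
  fixes g :: "'a \<Rightarrow> real"
  assumes "\<exists>!g. g \<in> extensional X \<and> (\<forall>x\<in>X. (\<Sum>y | y \<in> X \<and> le y x. g y) = (0 :: real))"
    and "\<And>x. x \<in> X \<Longrightarrow> (\<Sum>y | y \<in> X \<and> le y x. g y) = 0"
    and "x \<in> X"
  shows "g x = 0"
proof -
  have "(\<Sum>y | y \<in> X \<and> le y x. restrict g X y) = (\<Sum>y | y \<in> X \<and> le y x. g y)"
    and "(\<Sum>y | y \<in> X \<and> le y x. restrict (\<lambda>_. 0 :: real) X y) = 0" for x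
    by (auto intro: sum.cong)
  note sums = this
  obtain h where h: "\<forall>k. k \<in> extensional X \<and> (\<forall>x\<in>X. (\<Sum>y | y \<in> X \<and> le y x. k y) = (0 :: real)) \<longrightarrow> k = h"
    using assms(1) by (rule ex1E) (rule that)
  have "restrict g X = h"
    by (rule h[rule_format], intro conjI restrict_extensional ballI) (simp only: sums assms(2))
  moreover have "restrict (\<lambda>_. 0) X = h"
    by (rule h[rule_format], intro conjI restrict_extensional ballI) (simp only: sums)
  ultimately have "restrict g X = restrict (\<lambda>_. 0) X" by simp
  from fun_cong[OF this, of x] show ?thesis using \<open>x \<in> X\<close> by simp
qed

text \<open>Expanding the product of \<open>1 - 1\<close> over \<open>A\<close> gives the
  alternating sum over all subsets; removing the empty set and changing the sign leaves the
  claim.\<close>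

lemma sum_alternating_nonempty_subsets:
  assumes "finite A"
  shows "(\<Sum>R | R \<subseteq> A \<and> R \<noteq> {}. (-1) ^ (card R + 1)) = (of_bool (A \<noteq> {}) :: real)"
proof -
  have "(\<Sum>R\<in>Pow A. (-1) ^ card R) = (\<Prod>x\<in>A. 1 - 1 :: real)"
    by (subst prod_diff_conv_sum[OF assms]) simp
  also have "\<dots> = of_bool (A = {})"
    using assms by auto
  also have "Pow A = insert {} {R. R \<subseteq> A \<and> R \<noteq> {}}"
    by auto
  finally have "(\<Sum>R | R \<subseteq> A \<and> R \<noteq> {}. (-1) ^ card R) = (of_bool (A = {}) - 1 :: real)"
    using assms by (subst (asm) sum.insert) auto
  then have "(\<Sum>R | R \<subseteq> A \<and> R \<noteq> {}. - ((-1) ^ card R)) = (1 - of_bool (A = {}) :: real)"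
    by (simp add: sum_negf)
  then show ?thesis by auto
qed

section \<open>Functions of involution-exclusive sets\<close>

abbreviation exclusive_sets :: "nat \<Rightarrow> int set set" where
  "exclusive_sets d \<equiv> {T. involution_exclusive d T \<and> T \<noteq> {}}"

lemma finite_signed_indices: "finite (signed_indices d)"
proof (rule finite_subset)
  show "signed_indices d \<subseteq> {- int d..int d}" by (auto simp: signed_indices_def)
qed auto

lemma involution_exclusive_finite: "involution_exclusive d S \<Longrightarrow> finite S"
  using finite_signed_indices finite_subset by (auto simp: involution_exclusive_def)

lemma involution_exclusive_mono:
  "involution_exclusive d T \<Longrightarrow> R \<subseteq> T \<Longrightarrow> involution_exclusive d R"
  unfolding involution_exclusive_def by blast

lemma finite_exclusive_sets: "finite (exclusive_sets d)"
  by (rule finite_subset[of _ "Pow (signed_indices d)"])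
    (auto simp: involution_exclusive_def finite_signed_indices)

lemma special_exclusive: "special d S \<Longrightarrow> S \<in> exclusive_sets d"
  by (auto simp: special_def)

lemma finite_special: "finite {S. special d S}"
  by (rule finite_subset[OF _ finite_exclusive_sets]) (auto simp: special_def)

lemma involution_exclusive_uminus: "involution_exclusive d (uminus ` S) \<longleftrightarrow> involution_exclusive d S"
proof -
  have "involution_exclusive d (uminus ` S)" if "involution_exclusive d S" for S
    using that unfolding involution_exclusive_def
    by (auto simp: signed_indices_def image_image)
  from this[of S] this[of "uminus ` S"] show ?thesis
    by (auto simp: image_image)
qed

text \<open>\<open>S\<close> and \<open>-S\<close> share the least absolute value \<open>m\<close>.
  One of them contains \<open>m\<close>, and exclusivity forbids that both do.\<close>

lemma special_or_uminus_special:
  assumes "S \<in> exclusive_sets d"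
  shows "special d (uminus ` S) \<longleftrightarrow> \<not> special d S"
proof -
  define m where "m = Min (abs ` S)"
  have S: "involution_exclusive d S" "S \<noteq> {}" using assms by auto
  have "m \<in> abs ` S" unfolding m_def
    by (rule Min_in) (use S involution_exclusive_finite in auto)
  then have "m \<in> S \<or> m \<in> uminus ` S"
    by (auto simp: image_iff abs_if split: if_splits)
  moreover have "\<not> (m \<in> S \<and> m \<in> uminus ` S)"
    using S by (auto simp: involution_exclusive_def)
  moreover have "special d S \<longleftrightarrow> m \<in> S" using S by (simp add: special_def m_def)
  moreover have "special d (uminus ` S) \<longleftrightarrow> m \<in> uminus ` S"
    using S by (simp add: special_def m_def image_image involution_exclusive_uminus)
  ultimately show ?thesis by blast
qed

lemma uminus_image_uminus_image [simp]: "uminus ` uminus ` (S :: int set) = S"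
  by (auto simp: image_image)

section \<open>Moebius expansion in the functions \<open>[R \<subseteq> T]\<close>\<close>

text \<open>Inclusion-exclusion over the nonempty subsets \<open>R\<close> of
  \<open>S \<inter> T\<close>, which are exclusive because \<open>T\<close> is.\<close>

lemma moebius_hitting:
  assumes "T \<in> exclusive_sets d"
  shows "of_bool (S \<inter> T \<noteq> {}) =
    (\<Sum>R | R \<in> exclusive_sets d \<and> R \<subseteq> T. (-1) ^ (card R + 1) * (of_bool (R \<subseteq> S) :: real))"
proof -
  have fin: "finite T" using assms involution_exclusive_finite by auto
  have "of_bool (S \<inter> T \<noteq> {}) = (\<Sum>R | R \<subseteq> S \<inter> T \<and> R \<noteq> {}. (-1) ^ (card R + 1) :: real)"
    by (subst sum_alternating_nonempty_subsets) (use fin in auto)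
  also have "\<dots> = (\<Sum>R | R \<in> exclusive_sets d \<and> R \<subseteq> T. (-1) ^ (card R + 1) * of_bool (R \<subseteq> S))"
  proof (rule sum.mono_neutral_cong_left)
    show "finite {R. R \<in> exclusive_sets d \<and> R \<subseteq> T}"
      using finite_exclusive_sets by (rule rev_finite_subset) auto
    show "{R. R \<subseteq> S \<inter> T \<and> R \<noteq> {}} \<subseteq> {R. R \<in> exclusive_sets d \<and> R \<subseteq> T}"
      using assms involution_exclusive_mono by blast
  qed auto
  finally show ?thesis .
qed

text \<open>The left side is already one of the basis functions. Writing it as a sum over
  \<open>R\<close> matches the index set of \<open>moebius_hitting\<close>.\<close>

lemma moebius_containing:
  assumes "S \<in> exclusive_sets d"
  shows "of_bool (S \<subseteq> T) = (\<Sum>R | R \<in> exclusive_sets d \<and> R \<subseteq> T. (of_bool (R = S) :: real))"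
proof -
  have fin: "finite {R. R \<in> exclusive_sets d \<and> R \<subseteq> T}"
    using finite_exclusive_sets by (rule rev_finite_subset) auto
  show ?thesis
    using assms by (subst of_bool_def, subst sum.delta[OF fin]) auto
qed

text \<open>The rank is the cardinality in the first system and its negative in the second. The
  first inverts expansions in \<open>[R \<subseteq> T]\<close>; the second recovers \<open>c\<close>
  from its sums over special supersets.\<close>

lemma subset_system_ex1:
  fixes f :: "int set \<Rightarrow> real"
  assumes "\<X> \<subseteq> exclusive_sets d"
  shows "\<exists>!g. g \<in> extensional \<X> \<and> (\<forall>T\<in>\<X>. (\<Sum>R | R \<in> \<X> \<and> R \<subseteq> T. g R) = f T)"
    and "\<exists>!g. g \<in> extensional \<X> \<and> (\<forall>T\<in>\<X>. (\<Sum>R | R \<in> \<X> \<and> T \<subseteq> R. g R) = f T)"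
proof -
  have fin: "finite \<X>" "\<And>T. T \<in> \<X> \<Longrightarrow> finite T"
    using assms finite_exclusive_sets finite_subset involution_exclusive_finite by blast+
  show "\<exists>!g. g \<in> extensional \<X> \<and> (\<forall>T\<in>\<X>. (\<Sum>R | R \<in> \<X> \<and> R \<subseteq> T. g R) = f T)"
    by (rule triangular_system_ex1[where r = "\<lambda>R. real (card R)"])
      (use fin psubset_card_mono in \<open>auto simp: psubset_eq\<close>)
  show "\<exists>!g. g \<in> extensional \<X> \<and> (\<forall>T\<in>\<X>. (\<Sum>R | R \<in> \<X> \<and> T \<subseteq> R. g R) = f T)"
    by (rule triangular_system_ex1[where r = "\<lambda>R. - real (card R)" and le = "\<lambda>R T. T \<subseteq> R"])
      (use fin psubset_card_mono in \<open>auto simp: psubset_eq\<close>)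
qed

text \<open>The coefficient of \<open>T \<mapsto> [R \<subseteq> T]\<close> in the expansion of
  \<open>T \<mapsto> \<Sum>S. c S [S \<inter> T \<noteq> {}] + e S [-S \<subseteq> T]\<close>, where \<open>S\<close> ranges over the special sets.\<close>

definition moebius_coefficient ::
  "nat \<Rightarrow> (int set \<Rightarrow> real) \<Rightarrow> (int set \<Rightarrow> real) \<Rightarrow> int set \<Rightarrow> real" where
  "moebius_coefficient d c e R = (-1) ^ (card R + 1) * (\<Sum>S | special d S \<and> R \<subseteq> S. c S) +
     (if special d (uminus ` R) then e (uminus ` R) else 0)"

text \<open>Expand each summand over the same sets \<open>R\<close> and exchange the sums. For fixed
  \<open>R\<close>, the term in \<open>e\<close> survives only at \<open>S = -R\<close>, and only if
  that set is special.\<close>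

lemma moebius_expansion:
  assumes T: "T \<in> exclusive_sets d"
  shows "(\<Sum>S | special d S. c S * of_bool (S \<inter> T \<noteq> {}) + e S * of_bool (uminus ` S \<subseteq> T)) =
    (\<Sum>R | R \<in> exclusive_sets d \<and> R \<subseteq> T. moebius_coefficient d c e R)"
proof -
  let ?E = "{R. R \<in> exclusive_sets d \<and> R \<subseteq> T}" and ?Sp = "{S. special d S}"
  have "(\<Sum>S\<in>?Sp. c S * of_bool (S \<inter> T \<noteq> {}) + e S * of_bool (uminus ` S \<subseteq> T)) =
    (\<Sum>S\<in>?Sp. \<Sum>R\<in>?E. c S * ((-1) ^ (card R + 1) * of_bool (R \<subseteq> S)) + e S * of_bool (R = uminus ` S))"
  proof (rule sum.cong[OF refl])
    fix S assume "S \<in> ?Sp"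
    then have "uminus ` S \<in> exclusive_sets d"
      by (auto simp: special_def involution_exclusive_uminus)
    from moebius_containing[OF this, of T] moebius_hitting[OF T, of S]
    show "c S * of_bool (S \<inter> T \<noteq> {}) + e S * of_bool (uminus ` S \<subseteq> T) =
      (\<Sum>R\<in>?E. c S * ((-1) ^ (card R + 1) * of_bool (R \<subseteq> S)) + e S * of_bool (R = uminus ` S))"
      by (simp only: sum.distrib sum_distrib_left)
  qed
  also have "\<dots> = (\<Sum>R\<in>?E. \<Sum>S\<in>?Sp. c S * ((-1) ^ (card R + 1) * of_bool (R \<subseteq> S)) + e S * of_bool (R = uminus ` S))"
    by (rule sum.swap)
  also have "\<dots> = (\<Sum>R\<in>?E. moebius_coefficient d c e R)"
  proof (rule sum.cong[OF refl])
    fix R assume "R \<in> ?E"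
    have "(\<Sum>S\<in>?Sp. c S * ((-1) ^ (card R + 1) * of_bool (R \<subseteq> S))) =
      (-1) ^ (card R + 1) * (\<Sum>S | special d S \<and> R \<subseteq> S. c S)"
      unfolding sum_distrib_left
      by (rule sum.mono_neutral_cong_right) (auto simp: finite_special)
    moreover have "(\<Sum>S\<in>?Sp. e S * of_bool (R = uminus ` S)) =
      (\<Sum>S\<in>?Sp. if S = uminus ` R then e S else 0)"
      by (rule sum.cong) auto
    moreover have "\<dots> = (if special d (uminus ` R) then e (uminus ` R) else 0)"
      by (subst sum.delta) (auto simp: finite_special)
    ultimately show "(\<Sum>S\<in>?Sp. c S * ((-1) ^ (card R + 1) * of_bool (R \<subseteq> S)) + e S * of_bool (R = uminus ` S)) =
       moebius_coefficient d c e R"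
      unfolding sum.distrib moebius_coefficient_def by simp
  qed
  finally show ?thesis .
qed

text \<open>Let \<open>g\<close> be the Moebius coefficients of \<open>f\<close>. At special
  \<open>R\<close> the part with \<open>e\<close> is absent, which leaves a triangular system for
  \<open>c\<close>; at every other \<open>R\<close> the set \<open>-R\<close> is special and
  \<open>e\<close> at \<open>-R\<close> absorbs the difference.\<close>

lemma special_coefficients_exist:
  fixes f :: "int set \<Rightarrow> real"
  shows "\<exists>c e. \<forall>T\<in>exclusive_sets d.
    (\<Sum>S | special d S. c S * of_bool (S \<inter> T \<noteq> {}) + e S * of_bool (uminus ` S \<subseteq> T)) = f T"
proof -
  obtain g where g: "\<And>T. T \<in> exclusive_sets d \<Longrightarrow> (\<Sum>R | R \<in> exclusive_sets d \<and> R \<subseteq> T. g R) = f T"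
    using subset_system_ex1(1)[of "exclusive_sets d" d f] by (auto elim!: ex1E)
  have "{S. special d S} \<subseteq> exclusive_sets d" using special_exclusive by blast
  from subset_system_ex1(2)[OF this, of "\<lambda>R. (-1) ^ (card R + 1) * g R"]
  obtain c where c: "\<And>R. special d R \<Longrightarrow> (\<Sum>S | special d S \<and> R \<subseteq> S. c S) = (-1) ^ (card R + 1) * g R"
    by (auto elim!: ex1E)
  \<comment> \<open>Solves the coefficient equation at \<open>-S\<close>, whose sign exponent is the
    same because \<open>-S\<close> and \<open>S\<close> have equal cardinality.\<close>
  define e where "e S = g (uminus ` S) -
    (-1) ^ (card S + 1) * (\<Sum>S' | special d S' \<and> uminus ` S \<subseteq> S'. c S')" for S
  have "moebius_coefficient d c e R = g R" if R: "R \<in> exclusive_sets d" for R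
  proof (cases "special d R")
    case True
    have "(-1) ^ (card R + 1) * ((-1) ^ (card R + 1) * g R) = g R"
      by (simp flip: mult.assoc power_add)
    then show ?thesis
      using special_or_uminus_special[OF R] True by (simp only: moebius_coefficient_def c) simp
  next
    case False
    have "card (uminus ` R) = card R" by (rule card_image) auto
    then show ?thesis
      using special_or_uminus_special[OF R] False by (simp add: moebius_coefficient_def e_def)
  qed
  then have "(\<Sum>S | special d S. c S * of_bool (S \<inter> T \<noteq> {}) + e S * of_bool (uminus ` S \<subseteq> T)) = f T"
    if T: "T \<in> exclusive_sets d" for T
    unfolding moebius_expansion[OF T] g[OF T, symmetric] by (intro sum.cong) auto
  then show ?thesis by blast
qed

text \<open>All Moebius coefficients of the zero function vanish. Those at special sets give
  \<open>c = 0\<close> by triangularity, and then the one at \<open>-S\<close> is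
  \<open>e S\<close>.\<close>

lemma special_coefficients_unique:
  fixes c e :: "int set \<Rightarrow> real"
  assumes zero: "\<And>T. T \<in> exclusive_sets d \<Longrightarrow>
    (\<Sum>S | special d S. c S * of_bool (S \<inter> T \<noteq> {}) + e S * of_bool (uminus ` S \<subseteq> T)) = 0"
    and S: "special d S"
  shows "c S = 0" "e S = 0"
proof -
  let ?m = "moebius_coefficient d c e"
  have m0: "?m R = 0" if "R \<in> exclusive_sets d" for R
    by (rule ex1_zero_system_solution[OF subset_system_ex1(1)[of "exclusive_sets d" d "\<lambda>_. 0"]])
      (use zero that in \<open>simp_all only: moebius_expansion order_refl\<close>)
  have sub: "{S. special d S} \<subseteq> exclusive_sets d" using special_exclusive by blast
  have sums: "(\<Sum>S | special d S \<and> R \<subseteq> S. c S) = 0" if "special d R" for R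
    using m0[OF special_exclusive[OF that]] special_or_uminus_special[OF special_exclusive[OF that]] that
    by (simp add: moebius_coefficient_def)
  have c0: "c S = 0" if "special d S" for S
    by (rule ex1_zero_system_solution[OF subset_system_ex1(2)[OF sub, of "\<lambda>_. 0"]]) (use sums that in auto)
  then show "c S = 0" using S .
  have "uminus ` S \<in> exclusive_sets d"
    using S by (auto simp: special_def involution_exclusive_uminus)
  from m0[OF this] S c0 show "e S = 0"
    by (simp add: moebius_coefficient_def)
qed

section \<open>Support functions\<close>

definition support_function :: "'a::real_inner set \<Rightarrow> 'a \<Rightarrow> real" where
  "support_function P w = (SUP x\<in>P. w \<bullet> x)"

definition convex_body :: "'a::euclidean_space set \<Rightarrow> bool" where
  "convex_body P \<longleftrightarrow> compact P \<and> convex P \<and> P \<noteq> {}"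

lemma support_function_eq:
  assumes "v \<in> P" and "\<And>x. x \<in> P \<Longrightarrow> w \<bullet> x \<le> w \<bullet> v"
  shows "support_function P w = w \<bullet> v"
  unfolding support_function_def by (rule cSup_eq_maximum) (use assms in auto)

lemma support_function_attained:
  assumes "convex_body P"
  obtains v where "v \<in> P" "\<And>x. x \<in> P \<Longrightarrow> w \<bullet> x \<le> w \<bullet> v"
proof -
  have "continuous_on P (\<lambda>x. w \<bullet> x)" by (intro continuous_intros)
  then show ?thesis
    using continuous_attains_sup[of P "\<lambda>x. w \<bullet> x"] assms that unfolding convex_body_def by blast
qed

lemma convex_body_plus:
  assumes "convex_body A" "convex_body B"
  shows "convex_body (A + B)"
proof -
  have AB: "A + B = {x + y | x y. x \<in> A \<and> y \<in> B}" by (auto simp: set_plus_def)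
  have "compact (A + B)" unfolding AB using assms by (intro compact_sums) (auto simp: convex_body_def)
  moreover have "A + B \<noteq> {}" unfolding AB using assms by (auto simp: convex_body_def)
  ultimately show ?thesis using assms convex_set_plus[of A B] by (simp add: convex_body_def)
qed

lemma support_function_plus:
  assumes "convex_body A" "convex_body B"
  shows "support_function (A + B) w = support_function A w + support_function B w"
proof -
  obtain a b where ab: "a \<in> A" "\<And>x. x \<in> A \<Longrightarrow> w \<bullet> x \<le> w \<bullet> a" "b \<in> B" "\<And>x. x \<in> B \<Longrightarrow> w \<bullet> x \<le> w \<bullet> b"
    using assms support_function_attained by metis
  have "support_function (A + B) w = w \<bullet> (a + b)"
    by (rule support_function_eq) (use ab in \<open>auto simp: set_plus_def inner_add_right intro!: add_mono\<close>)
  then show ?thesis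
    using support_function_eq[of a A w] support_function_eq[of b B w] ab by (simp add: inner_add_right)
qed

lemma convex_body_scaleR: "convex_body A \<Longrightarrow> convex_body ((*\<^sub>R) c ` A)"
  by (auto simp: convex_body_def intro: compact_scaling convex_scaling)

lemma support_function_scaleR:
  assumes "convex_body A" "0 \<le> c"
  shows "support_function ((*\<^sub>R) c ` A) w = c * support_function A w"
proof -
  obtain a where a: "a \<in> A" "\<And>x. x \<in> A \<Longrightarrow> w \<bullet> x \<le> w \<bullet> a"
    using assms support_function_attained by metis
  have "support_function ((*\<^sub>R) c ` A) w = w \<bullet> (c *\<^sub>R a)"
    by (rule support_function_eq) (use a assms(2) in \<open>auto intro!: mult_left_mono\<close>)
  then show ?thesis using support_function_eq[of a A w] a by simp
qed

text \<open>Additivity is proved together with the body property, which the induction step needs for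
  the partial sum.\<close>

lemma support_function_sum:
  assumes "finite I" "\<And>i. i \<in> I \<Longrightarrow> convex_body (A i)"
  shows "convex_body (\<Sum>i\<in>I. A i) \<and>
    support_function (\<Sum>i\<in>I. A i) w = (\<Sum>i\<in>I. support_function (A i) w)"
  using assms
proof (induction I rule: finite_induct)
  case empty
  show ?case by (auto simp: convex_body_def support_function_def set_zero)
next
  case (insert i I)
  then have "convex_body (A i)" "convex_body (\<Sum>i\<in>I. A i)" by auto
  from convex_body_plus[OF this] support_function_plus[OF this] show ?case
    using insert by simp
qed

text \<open>A point of \<open>A\<close> outside the closed set \<open>B\<close> is cut off by a
  hyperplane, and in a normal direction of it the support function of \<open>A\<close> would exceed
  that of \<open>B\<close>.\<close>

lemma support_function_le_imp_subset:
  assumes "convex_body A" "convex_body B" "\<And>w. support_function A w \<le> support_function B w"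
  shows "A \<subseteq> B"
proof (rule subsetI, rule ccontr)
  fix z assume z: "z \<in> A" "z \<notin> B"
  obtain a b where ab: "a \<bullet> z < b" "\<And>x. x \<in> B \<Longrightarrow> b < a \<bullet> x"
    using separating_hyperplane_closed_point[of B z] z assms(2) compact_imp_closed
    unfolding convex_body_def by blast
  \<comment> \<open>\<open>z\<close> lies on the lower side of the hyperplane, so the inequality
    fails in direction \<open>- a\<close>.\<close>
  obtain x where x: "x \<in> A" "\<And>y. y \<in> A \<Longrightarrow> - a \<bullet> y \<le> - a \<bullet> x"
    using support_function_attained[OF assms(1)] by metis
  obtain y where y: "y \<in> B" "\<And>x. x \<in> B \<Longrightarrow> - a \<bullet> x \<le> - a \<bullet> y"
    using support_function_attained[OF assms(2)] by metis
  have "- a \<bullet> x \<le> - a \<bullet> y"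
    using assms(3)[of "- a"] support_function_eq[OF x] support_function_eq[OF y] by simp
  then show False using x(2)[OF z(1)] ab(1) ab(2)[OF y(1)] by simp
qed

lemma convex_body_eq_iff:
  assumes "convex_body A" "convex_body B"
  shows "A = B \<longleftrightarrow> (\<forall>w. support_function A w = support_function B w)"
  using support_function_le_imp_subset[OF assms] support_function_le_imp_subset[OF assms(2,1)]
  by (metis order_refl subset_antisym)

text \<open>With the negative terms on the left, both sides are convex bodies and are determined by
  their support functions, which are additive and homogeneous for nonnegative factors. For these
  real values the negative terms can be moved back by subtraction.\<close>

lemma signed_Minkowski_sum_iff:
  assumes "finite \<Q>" "\<And>Q. Q \<in> \<Q> \<Longrightarrow> convex_body Q" "convex_body P"
  shows "signed_Minkowski_sum P \<Q> y \<longleftrightarrow>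
    (\<forall>w. support_function P w = (\<Sum>Q\<in>\<Q>. y Q * support_function Q w))"
proof -
  let ?N = "{Q\<in>\<Q>. y Q < 0}" and ?P = "{Q\<in>\<Q>. y Q > 0}"
  let ?SN = "\<Sum>Q\<in>?N. (*\<^sub>R) \<bar>y Q\<bar> ` Q" and ?SP = "\<Sum>Q\<in>?P. (*\<^sub>R) (y Q) ` Q"
  have fin: "finite ?N" "finite ?P" using assms(1) by auto
  have N: "convex_body ?SN" "support_function ?SN w = (\<Sum>Q\<in>?N. \<bar>y Q\<bar> * support_function Q w)" for w
  proof -
    have body: "convex_body ((*\<^sub>R) \<bar>y Q\<bar> ` Q)"
      "support_function ((*\<^sub>R) \<bar>y Q\<bar> ` Q) w = \<bar>y Q\<bar> * support_function Q w" if "Q \<in> ?N" for Q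
    proof -
      have "convex_body Q" "0 \<le> \<bar>y Q\<bar>" using that assms(2) by auto
      then show "convex_body ((*\<^sub>R) \<bar>y Q\<bar> ` Q)"
        "support_function ((*\<^sub>R) \<bar>y Q\<bar> ` Q) w = \<bar>y Q\<bar> * support_function Q w"
        using convex_body_scaleR support_function_scaleR by blast+
    qed
    note sum = support_function_sum[OF fin(1), of "\<lambda>Q. (*\<^sub>R) \<bar>y Q\<bar> ` Q", OF body(1)]
    show "convex_body ?SN" using sum by blast
    show "support_function ?SN w = (\<Sum>Q\<in>?N. \<bar>y Q\<bar> * support_function Q w)"
      by (rule trans[OF conjunct2[OF sum] sum.cong[OF refl body(2)]])
  qed
  have P: "convex_body ?SP" "support_function ?SP w = (\<Sum>Q\<in>?P. y Q * support_function Q w)" for w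
  proof -
    have body: "convex_body ((*\<^sub>R) (y Q) ` Q)"
      "support_function ((*\<^sub>R) (y Q) ` Q) w = y Q * support_function Q w" if "Q \<in> ?P" for Q
    proof -
      have "convex_body Q" "0 \<le> y Q" using that assms(2) by auto
      then show "convex_body ((*\<^sub>R) (y Q) ` Q)"
        "support_function ((*\<^sub>R) (y Q) ` Q) w = y Q * support_function Q w"
        using convex_body_scaleR support_function_scaleR by blast+
    qed
    note sum = support_function_sum[OF fin(2), of "\<lambda>Q. (*\<^sub>R) (y Q) ` Q", OF body(1)]
    show "convex_body ?SP" using sum by blast
    show "support_function ?SP w = (\<Sum>Q\<in>?P. y Q * support_function Q w)"
      by (rule trans[OF conjunct2[OF sum] sum.cong[OF refl body(2)]])
  qed
  have split: "(\<Sum>Q\<in>\<Q>. y Q * support_function Q w) =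
    (\<Sum>Q\<in>?P. y Q * support_function Q w) - (\<Sum>Q\<in>?N. \<bar>y Q\<bar> * support_function Q w)" for w
  proof -
    \<comment> \<open>Terms with \<open>y Q = 0\<close> belong to neither index set and contribute
      nothing.\<close>
    have "(\<Sum>Q\<in>\<Q>. y Q * support_function Q w) = (\<Sum>Q\<in>?P \<union> ?N. y Q * support_function Q w)"
      by (rule sum.mono_neutral_right) (use assms(1) in auto)
    also have "\<dots> = (\<Sum>Q\<in>?P. y Q * support_function Q w) + (\<Sum>Q\<in>?N. y Q * support_function Q w)"
      by (rule sum.union_disjoint) (use fin in auto)
    also have "(\<Sum>Q\<in>?N. y Q * support_function Q w) = - (\<Sum>Q\<in>?N. \<bar>y Q\<bar> * support_function Q w)"
      unfolding sum_negf[symmetric] by (rule sum.cong) auto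
    finally show ?thesis by simp
  qed
  have "signed_Minkowski_sum P \<Q> y \<longleftrightarrow> P + ?SN = ?SP"
    using assms(1) by (simp add: signed_Minkowski_sum_def)
  also have "\<dots> \<longleftrightarrow> (\<forall>w. support_function (P + ?SN) w = support_function ?SP w)"
    by (rule convex_body_eq_iff) (use convex_body_plus assms(3) N(1) P(1) in blast)+
  finally show ?thesis
    unfolding support_function_plus[OF assms(3) N(1)] N(2) P(2) split by (simp add: algebra_simps)
qed

section \<open>Linearity on the cones of the type B fan\<close>

text \<open>For \<open>t > 0\<close> this is the sign of \<open>x\<close> where
  \<open>\<bar>x\<bar> \<ge> t\<close> and 0 elsewhere. Thus \<open>level t w\<close> is the ray
  vector of the signed indices at which \<open>w\<close> is at least \<open>t\<close>.\<close>

definition step :: "real \<Rightarrow> real \<Rightarrow> real" where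
  "step t x = (if t \<le> x then 1 else if x \<le> - t then -1 else 0)"

definition level :: "real \<Rightarrow> real ^ 'n \<Rightarrow> real ^ 'n" where
  "level t w = (\<chi> j. step t (w $ j))"

lemma step_uminus: "0 < t \<Longrightarrow> step t (- x) = - step t x"
  by (auto simp: step_def)

lemma step_mono: "0 < t \<Longrightarrow> x \<le> y \<Longrightarrow> step t x \<le> step t y"
  by (auto simp: step_def)

text \<open>The weights are the gaps between consecutive elements of \<open>L\<close>, the first
  counted from 0, so their partial sums telescope.\<close>

lemma positive_layers:
  fixes L :: "real set"
  assumes "finite L" "\<And>t. t \<in> L \<Longrightarrow> 0 < t"
  shows "\<exists>l. (\<forall>t\<in>L. 0 \<le> l t) \<and> (\<forall>x\<in>L. (\<Sum>t | t \<in> L \<and> t \<le> x. l t) = x)"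
  using assms
proof (induction L rule: finite_linorder_max_induct)
  case empty
  show ?case by simp
next
  case (insert b L)
  have "\<exists>l. (\<forall>t\<in>L. 0 \<le> l t) \<and> (\<forall>x\<in>L. (\<Sum>t | t \<in> L \<and> t \<le> x. l t) = x)"
    using insert.prems by (intro insert.IH) auto
  then obtain l where l: "\<And>t. t \<in> L \<Longrightarrow> 0 \<le> l t" "\<And>x. x \<in> L \<Longrightarrow> (\<Sum>t | t \<in> L \<and> t \<le> x. l t) = x"
    by blast
  have b: "b \<notin> L" "0 < b" using insert by auto
  \<comment> \<open>The gap between \<open>Max L\<close> and \<open>b\<close>, or \<open>b\<close>
    itself if \<open>L\<close> is empty: the equation at \<open>Max L\<close> says that the old
    weights sum to \<open>Max L\<close>.\<close>
  define v where "v = b - (\<Sum>t\<in>L. l t)"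
  have "(\<Sum>t\<in>L. l t) \<le> b"
  proof (cases "L = {}")
    case False
    then have "Max L \<in> L" "{t. t \<in> L \<and> t \<le> Max L} = L" using insert.hyps(1) by auto
    then show ?thesis using l(2)[of "Max L"] insert.hyps(2) by force
  qed (use b in auto)
  then have "\<forall>t\<in>insert b L. 0 \<le> (l(b := v)) t"
    using l(1) by (auto simp: v_def)
  moreover have "\<forall>x\<in>insert b L. (\<Sum>t | t \<in> insert b L \<and> t \<le> x. (l(b := v)) t) = x"
  proof
    have upd: "(\<Sum>t\<in>A. (l(b := v)) t) = (\<Sum>t\<in>A. l t)" if "A \<subseteq> L" for A
      using b that by (intro sum.cong) auto
    fix x assume "x \<in> insert b L"
    then consider "x = b" | "x \<in> L" by blast
    then show "(\<Sum>t | t \<in> insert b L \<and> t \<le> x. (l(b := v)) t) = x"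
    proof cases
      case 1
      have "{t. t \<in> insert b L \<and> t \<le> x} = insert b L"
        using insert.hyps(2) 1 by (auto simp: less_imp_le)
      moreover have "(\<Sum>t\<in>insert b L. (l(b := v)) t) = v + (\<Sum>t\<in>L. l t)"
        using b insert.hyps(1) upd[of L] by (subst sum.insert) (auto simp del: fun_upd_apply simp: fun_upd_same)
      ultimately show ?thesis using 1 by (simp only: v_def)
    next
      case 2
      have "{t. t \<in> insert b L \<and> t \<le> x} = {t. t \<in> L \<and> t \<le> x}"
        using insert.hyps(2) 2 by force
      then show ?thesis using upd[of "{t. t \<in> L \<and> t \<le> x}"] l(2)[OF 2] by simp
    qed
  qed
  ultimately show ?case by blast
qed

text \<open>Layer-cake formula with the nonzero absolute values of the coordinates as thresholds. A
  positive coordinate is the sum of the gaps below it; negative ones follow because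
  \<open>step t\<close> is odd.\<close>

lemma layer_decomposition:
  fixes w :: "real ^ 'n"
  obtains L l where "finite L" "\<And>t. t \<in> L \<Longrightarrow> 0 < t" "\<And>t. t \<in> L \<Longrightarrow> 0 \<le> l t"
    "w = (\<Sum>t\<in>L. l t *\<^sub>R level t w)"
proof -
  define L where "L = range (\<lambda>j. \<bar>w $ j\<bar>) - {0}"
  have L: "finite L" "\<And>t. t \<in> L \<Longrightarrow> 0 < t" by (auto simp: L_def)
  obtain l where l: "\<And>t. t \<in> L \<Longrightarrow> 0 \<le> l t" "\<And>x. x \<in> L \<Longrightarrow> (\<Sum>t | t \<in> L \<and> t \<le> x. l t) = x"
    using positive_layers[OF L] by auto
  have pos: "(\<Sum>t\<in>L. l t * step t x) = x" if "x \<in> L" for x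
  proof -
    have "(\<Sum>t\<in>L. l t * step t x) = (\<Sum>t | t \<in> L \<and> t \<le> x. l t)"
    proof (rule sum.mono_neutral_cong_right)
      show "\<forall>t\<in>L - {t. t \<in> L \<and> t \<le> x}. l t * step t x = 0"
        using L(2) L(2)[OF that] by (intro ballI) (auto simp: step_def dest!: L(2))
    qed (use L(1) in \<open>auto simp: step_def\<close>)
    then show ?thesis using l(2)[OF that] by simp
  qed
  have "w $ j = (\<Sum>t\<in>L. l t * step t (w $ j))" for j
  proof -
    consider "w $ j = 0" | "w $ j \<in> L" | "- (w $ j) \<in> L"
    proof -
      have "w $ j = 0 \<or> \<bar>w $ j\<bar> \<in> L" by (auto simp: L_def)
      then show ?thesis using that by (cases "0 \<le> w $ j") auto
    qed
    then show ?thesis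
    proof cases
      case 1
      have "(\<Sum>t\<in>L. l t * step t 0) = 0"
        by (rule sum.neutral) (auto simp: step_def dest!: L(2))
      then show ?thesis using 1 by simp
    next
      case 2
      then show ?thesis using pos by simp
    next
      case 3
      have "(\<Sum>t\<in>L. l t * step t (- (w $ j))) = - (\<Sum>t\<in>L. l t * step t (w $ j))"
        unfolding sum_negf[symmetric] using L(2) by (intro sum.cong) (auto simp: step_uminus)
      then show ?thesis using pos[OF 3] by simp
    qed
  qed
  then have "w = (\<Sum>t\<in>L. l t *\<^sub>R level t w)"
    by (simp add: vec_eq_iff level_def)
  then show ?thesis using that L l(1) by blast
qed

text \<open>The vectors \<open>level t w\<close> with \<open>t > 0\<close> span the cone of the type B fan that contains \<open>w\<close> in its
  relative interior, so this says that the support function of \<open>Q\<close> is linear on every such cone.\<close>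

definition type_B_linear :: "(real ^ 'n::finite) set \<Rightarrow> bool" where
  "type_B_linear Q \<longleftrightarrow> (\<forall>w. \<exists>v\<in>Q. \<forall>t>0. \<forall>q\<in>Q. level t w \<bullet> q \<le> level t w \<bullet> v)"

text \<open>One point of \<open>Q\<close> maximizes all layers of \<open>w\<close> at once, hence
  also their nonnegative combination \<open>w\<close>. Since \<open>L\<close> and \<open>l\<close>
  are chosen before \<open>Q\<close>, the formulas for different \<open>Q\<close> can be combined
  linearly.\<close>

lemma support_function_layers:
  fixes w :: "real ^ 'n::finite"
  obtains L l where "\<And>t. t \<in> L \<Longrightarrow> 0 < t"
    "\<And>Q. type_B_linear Q \<Longrightarrow> support_function Q w = (\<Sum>t\<in>L. l t * support_function Q (level t w))"
proof -
  obtain L l where L: "finite L" "\<And>t. t \<in> L \<Longrightarrow> 0 < t" "\<And>t. t \<in> L \<Longrightarrow> 0 \<le> l t"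
    "w = (\<Sum>t\<in>L. l t *\<^sub>R level t w)"
    using layer_decomposition[of w] by metis
  have inner: "w \<bullet> q = (\<Sum>t\<in>L. l t * (level t w \<bullet> q))" for q
    by (subst L(4)) (simp add: inner_sum_left)
  have "support_function Q w = (\<Sum>t\<in>L. l t * support_function Q (level t w))" if Q: "type_B_linear Q" for Q
  proof -
    obtain v where v: "v \<in> Q" "\<And>t q. t > 0 \<Longrightarrow> q \<in> Q \<Longrightarrow> level t w \<bullet> q \<le> level t w \<bullet> v"
      using Q unfolding type_B_linear_def by metis
    have "support_function Q w = w \<bullet> v"
      by (rule support_function_eq) (use v L in \<open>auto simp: inner intro!: sum_mono mult_left_mono\<close>)
    also have "\<dots> = (\<Sum>t\<in>L. l t * support_function Q (level t w))"
      unfolding inner using v L(2) support_function_eq[of v Q] by (intro sum.cong) auto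
    finally show ?thesis .
  qed
  then show ?thesis using that L(2) by blast
qed

section \<open>Maximization over vertices, and the simplices\<close>

lemma inner_hull_le:
  assumes "\<And>v. v \<in> V \<Longrightarrow> w \<bullet> v \<le> c" and "q \<in> convex hull V"
  shows "w \<bullet> q \<le> c"
proof -
  have "convex hull V \<subseteq> {x. w \<bullet> x \<le> c}"
    by (rule hull_minimal) (use assms(1) convex_halfspace_le in auto)
  then show ?thesis using assms(2) by auto
qed

lemma support_function_hull:
  assumes "v \<in> V" and "\<And>x. x \<in> V \<Longrightarrow> w \<bullet> x \<le> w \<bullet> v"
  shows "support_function (convex hull V) w = w \<bullet> v"
  by (rule support_function_eq[OF hull_inc[OF assms(1)] inner_hull_le[OF assms(2)]])

lemma inner_signed_unit:
  "w \<bullet> signed_unit idx i = real_of_int (sgn i) * w $ idx (nat \<bar>i\<bar>)"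
  by (simp add: signed_unit_def inner_axis)

text \<open>The inner product with a signed unit vector is plus or minus a coordinate, or 0, and
  \<open>step t\<close> is odd.\<close>

lemma level_inner_signed_unit:
  assumes "0 < t"
  shows "level t w \<bullet> signed_unit idx i = step t (w \<bullet> signed_unit idx i)"
proof -
  consider "sgn i = 1" | "sgn i = 0" | "sgn i = -1" by (cases i "0 :: int" rule: linorder_cases) auto
  then show ?thesis
    using assms by cases (simp_all add: inner_signed_unit level_def step_uminus, simp add: step_def)
qed

lemma type_B_linear_hull:
  assumes "v \<in> V" "\<And>t x. 0 < t \<Longrightarrow> x \<in> V \<Longrightarrow> level t w \<bullet> x \<le> level t w \<bullet> v"
  shows "\<exists>v\<in>convex hull V. \<forall>t>0. \<forall>q\<in>convex hull V. level t w \<bullet> q \<le> level t w \<bullet> v"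
proof (intro bexI allI impI ballI)
  show "v \<in> convex hull V" by (rule hull_inc[OF assms(1)])
  fix t :: real and q assume "0 < t" "q \<in> convex hull V"
  then show "level t w \<bullet> q \<le> level t w \<bullet> v" using inner_hull_le[OF assms(2)] by metis
qed

lemma finite_arg_max:
  fixes f :: "'a \<Rightarrow> real"
  assumes "finite S" "S \<noteq> {}"
  obtains i where "i \<in> S" "\<And>j. j \<in> S \<Longrightarrow> f j \<le> f i"
proof -
  have "Max (f ` S) \<in> f ` S" using assms by (intro Max_in) auto
  then obtain i where "i \<in> S" "f i = Max (f ` S)" by auto
  then show ?thesis using that assms by (metis Max_ge finite_imageI imageI)
qed

text \<open>On the vertices, \<open>level t w\<close> is the image of \<open>w\<close> under the
  monotone function \<open>step t\<close>, so a vertex that maximizes \<open>w\<close> maximizes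
  every level. The vertex 0 fits in because \<open>step t 0 = 0\<close> for
  \<open>t > 0\<close>.\<close>

lemma type_B_linear_Simplex:
  assumes "finite S" "S \<noteq> {}"
  shows "type_B_linear (Simplex idx S)" "type_B_linear (Simplex0 idx S)"
proof -
  show "type_B_linear (Simplex idx S)"
    unfolding type_B_linear_def Simplex_def
  proof
    fix w :: "real ^ 'a"
    obtain i where i: "i \<in> S" "\<And>j. j \<in> S \<Longrightarrow> w \<bullet> signed_unit idx j \<le> w \<bullet> signed_unit idx i"
      using finite_arg_max[OF assms, of "\<lambda>j. w \<bullet> signed_unit idx j"] by metis
    show "\<exists>v\<in>convex hull signed_unit idx ` S. \<forall>t>0. \<forall>q\<in>convex hull signed_unit idx ` S.
        level t w \<bullet> q \<le> level t w \<bullet> v"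
      by (rule type_B_linear_hull[of "signed_unit idx i"])
        (use i in \<open>auto simp: level_inner_signed_unit step_mono\<close>)
  qed
  show "type_B_linear (Simplex0 idx S)"
    unfolding type_B_linear_def Simplex0_def
  proof
    fix w :: "real ^ 'a"
    let ?V = "{0} \<union> signed_unit idx ` S"
    obtain v where v: "v \<in> ?V" "\<And>x. x \<in> ?V \<Longrightarrow> w \<bullet> x \<le> w \<bullet> v"
      using finite_arg_max[of ?V "\<lambda>j. w \<bullet> j"] assms by auto
    have lev: "level t w \<bullet> x = step t (w \<bullet> x)" if "0 < t" "x \<in> ?V" for t x
      using that by (auto simp: level_inner_signed_unit step_def)
    show "\<exists>v\<in>convex hull ?V. \<forall>t>0. \<forall>q\<in>convex hull ?V. level t w \<bullet> q \<le> level t w \<bullet> v"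
      by (rule type_B_linear_hull[of v]) (use v in \<open>auto simp only: lev intro!: step_mono\<close>)
  qed
qed

lemma convex_body_hull: "finite V \<Longrightarrow> V \<noteq> {} \<Longrightarrow> convex_body (convex hull V)"
  by (simp add: convex_body_def finite_imp_compact_convex_hull)

lemma convex_body_special_simplices:
  "Q \<in> special_simplices d idx \<Longrightarrow> convex_body Q"
  unfolding special_simplices_def Simplex_def Simplex0_def special_def
  by (elim UnE imageE) (auto intro!: convex_body_hull dest: involution_exclusive_finite)

section \<open>The type B permutahedron and its generalizations\<close>

text \<open>Elements enter in order of increasing \<open>f\<close> and each new one receives the
  next number; ties are broken by the order of entry.\<close>

lemma bij_betw_sorting:
  fixes f :: "'a \<Rightarrow> real"
  assumes "finite A"
  shows "\<exists>\<sigma>. bij_betw \<sigma> A {1..card A} \<and> (\<forall>i\<in>A. \<forall>j\<in>A. f i < f j \<longrightarrow> \<sigma> i < \<sigma> j)"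
  using assms
proof (induction A rule: finite_ranking_induct[where f = f])
  case empty
  show ?case by (auto simp: bij_betw_def)
next
  case (insert x A)
  show ?case
  proof (cases "x \<in> A")
    case True
    then show ?thesis using insert.IH by (simp add: insert_absorb)
  next
    case False
    obtain \<sigma> where \<sigma>: "bij_betw \<sigma> A {1..card A}" "\<And>i j. i \<in> A \<Longrightarrow> j \<in> A \<Longrightarrow> f i < f j \<Longrightarrow> \<sigma> i < \<sigma> j"
      using insert.IH by blast
    let ?\<sigma> = "\<sigma>(x := Suc (card A))"
    have "bij_betw ?\<sigma> A {1..card A}"
      using \<sigma>(1) by (rule bij_betw_cong[THEN iffD1, rotated]) (use False in auto)
    then have "bij_betw ?\<sigma> (A \<union> {x}) ({1..card A} \<union> {?\<sigma> x})"
      by (rule notIn_Un_bij_betw[rotated 2]) (use False in auto)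
    moreover have "{1..card A} \<union> {?\<sigma> x} = {1..card (insert x A)}"
      using False insert.hyps(1) by auto
    ultimately have bij: "bij_betw ?\<sigma> (insert x A) {1..card (insert x A)}" by simp
    have lt: "\<sigma> i < Suc (card A)" if "i \<in> A" for i
      using bij_betwE[OF \<sigma>(1)] that by force
    have "?\<sigma> i < ?\<sigma> j" if "i \<in> insert x A" "j \<in> insert x A" "f i < f j" for i j
      using that insert.hyps(2)[of j] \<sigma>(2) lt False by auto
    then show ?thesis using bij by blast
  qed
qed

text \<open>Cancel the common part. The remainders have equal cardinality, and
  \<open>Max (A - B)\<close> bounds the one from above and the other from below.\<close>

lemma sum_le_sum_upper_set:
  fixes A B :: "nat set"
  assumes "finite A" "finite B" "card A = card B" "\<And>a b. a \<in> A - B \<Longrightarrow> b \<in> B - A \<Longrightarrow> a \<le> b"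
  shows "\<Sum>A \<le> \<Sum>B"
proof -
  have card: "card (A - B) = card (B - A)"
    using assms(1-3) by (metis card_Diff_subset_Int finite_Int inf_commute)
  have "\<Sum>(A - B) \<le> \<Sum>(B - A)"
  proof (cases "A - B = {}")
    case True
    then show ?thesis unfolding True by simp
  next
    case False
    then have m: "Max (A - B) \<in> A - B" using assms(1) by (intro Max_in) auto
    have "\<Sum>(A - B) \<le> of_nat (card (A - B)) * Max (A - B)"
      using assms(1) by (intro sum_bounded_above) auto
    also have "\<dots> \<le> \<Sum>(B - A)"
      unfolding card using assms(4) m by (intro sum_bounded_below) auto
    finally show ?thesis .
  qed
  moreover have "\<Sum>A = \<Sum>(A - B) + \<Sum>(A \<inter> B)" "\<Sum>B = \<Sum>(B - A) + \<Sum>(A \<inter> B)"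
    using sum.Int_Diff[OF assms(1), of "\<lambda>x. x" B] sum.Int_Diff[OF assms(2), of "\<lambda>x. x" A]
    by (simp_all add: Int_commute[of B A])
  ultimately show ?thesis by simp
qed

text \<open>\<open>\<sigma>\<close> puts the largest values on \<open>T\<close>: a value taken by
  \<open>\<tau>\<close> on \<open>T\<close> but not by \<open>\<sigma>\<close> is taken by
  \<open>\<sigma>\<close> outside \<open>T\<close>, hence is smaller.\<close>

lemma permutation_sum_le_upper_set:
  assumes \<sigma>: "\<sigma> permutes {1..d}" and \<tau>: "\<tau> permutes {1..d}" and T: "T \<subseteq> {1..d}"
    and upper: "\<And>i j. i \<in> T \<Longrightarrow> j \<in> {1..d} - T \<Longrightarrow> \<sigma> j < \<sigma> i"
  shows "(\<Sum>i\<in>T. \<tau> i) \<le> (\<Sum>i\<in>T. \<sigma> i :: nat)"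
proof -
  have fin: "finite T" using T finite_subset by blast
  have inj: "inj_on \<tau> T" "inj_on \<sigma> T"
    using \<sigma> \<tau> permutes_inj_on by blast+
  have "\<Sum>(\<tau> ` T) \<le> \<Sum>(\<sigma> ` T)"
  proof (rule sum_le_sum_upper_set)
    fix a b assume a: "a \<in> \<tau> ` T - \<sigma> ` T" and b: "b \<in> \<sigma> ` T - \<tau> ` T"
    have "a \<in> {1..d}" using a T permutes_in_image[OF \<tau>] by blast
    then have "a \<in> \<sigma> ` {1..d}" using permutes_image[OF \<sigma>] by simp
    then obtain j where "j \<in> {1..d} - T" "a = \<sigma> j" using a by blast
    then show "a \<le> b" using b upper by (auto intro: less_imp_le)
  qed (use fin inj in \<open>auto simp: card_image\<close>)
  then show ?thesis using inj by (simp add: sum.reindex)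
qed

text \<open>The maximizing vertex ranks the coordinates by their absolute values in \<open>w\<close>
  and copies the signs of \<open>w\<close>. Every set of coordinates cut out by a threshold then
  receives the largest numbers, so one vertex serves all \<open>t\<close>.\<close>

lemma type_B_linear_permutahedron_B:
  fixes idx :: "nat \<Rightarrow> 'n::finite"
  assumes idx: "bij_betw idx {1..d} UNIV"
  shows "type_B_linear (permutahedron_B d idx)"
  unfolding type_B_linear_def permutahedron_B_def
proof
  fix w :: "real ^ 'n"
  obtain \<rho> where \<rho>: "bij_betw \<rho> {1..d} {1..d}"
    "\<And>i j. i \<in> {1..d} \<Longrightarrow> j \<in> {1..d} \<Longrightarrow> \<bar>w $ idx i\<bar> < \<bar>w $ idx j\<bar> \<Longrightarrow> \<rho> i < \<rho> j"
    using bij_betw_sorting[of "{1..d}" "\<lambda>i. \<bar>w $ idx i\<bar>"] by auto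
  \<comment> \<open>\<open>permutes\<close> demands the identity outside
    \<open>{1..d}\<close>.\<close>
  define \<sigma> where "\<sigma> i = (if i \<in> {1..d} then \<rho> i else i)" for i
  have "bij_betw \<sigma> {1..d} {1..d} \<longleftrightarrow> bij_betw \<rho> {1..d} {1..d}"
    by (rule bij_betw_cong) (simp add: \<sigma>_def)
  then have \<sigma>: "\<sigma> permutes {1..d}"
    by (intro bij_imp_permutes) (use \<rho>(1) in \<open>auto simp: \<sigma>_def\<close>)
  define \<epsilon> :: "nat \<Rightarrow> real" where "\<epsilon> i = (if 0 \<le> w $ idx i then 1 else -1)" for i
  define x :: "real ^ 'n" where
    "x = (\<chi> j. \<epsilon> (inv_into {1..d} idx j) * real (\<sigma> (inv_into {1..d} idx j)))"
  have x: "x $ idx i = \<epsilon> i * real (\<sigma> i)" if "i \<in> {1..d}" for i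
    using that idx by (simp add: x_def bij_betw_inv_into_left)
  have inner: "u \<bullet> y = (\<Sum>i\<in>{1..d}. u $ idx i * y $ idx i)" for u y :: "real ^ 'n"
    unfolding inner_vec_def using sum.reindex_bij_betw[OF idx, of "\<lambda>j. u $ j * y $ j"] by simp
  show "\<exists>v\<in>convex hull signed_permutations d idx. \<forall>t>0. \<forall>q\<in>convex hull signed_permutations d idx.
      level t w \<bullet> q \<le> level t w \<bullet> v"
  proof (rule type_B_linear_hull)
    show "x \<in> signed_permutations d idx"
    proof -
      have "\<forall>i\<in>{1..d}. \<epsilon> i \<in> {1, -1}" by (simp add: \<epsilon>_def)
      then show ?thesis unfolding signed_permutations_def using \<sigma> x by blast
    qed
  next
    fix t :: real and y assume t: "0 < t" and "y \<in> signed_permutations d idx"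
    then obtain \<tau> \<delta> where \<tau>: "\<tau> permutes {1..d}" and \<delta>: "\<And>i. i \<in> {1..d} \<Longrightarrow> \<delta> i \<in> {1, -1 :: real}"
      and y: "\<And>i. i \<in> {1..d} \<Longrightarrow> y $ idx i = \<delta> i * real (\<tau> i)"
      unfolding signed_permutations_def by blast
    define T where "T = {i\<in>{1..d}. t \<le> \<bar>w $ idx i\<bar>}"
    have abs: "(\<Sum>i\<in>{1..d}. of_bool (i \<in> T) * real (\<kappa> i)) = real (\<Sum>i\<in>T. \<kappa> i)" for \<kappa> :: "nat \<Rightarrow> nat"
    proof -
      have "(\<Sum>i\<in>{1..d}. of_bool (i \<in> T) * real (\<kappa> i)) = (\<Sum>i\<in>T. real (\<kappa> i))"
        by (rule sum.mono_neutral_cong_right) (auto simp: T_def)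
      then show ?thesis by simp
    qed
    \<comment> \<open>Ignoring signs gives an upper bound, which \<open>x\<close> attains because
      its signs agree with those of \<open>w\<close> on \<open>T\<close>.\<close>
    have "level t w \<bullet> y \<le> (\<Sum>i\<in>{1..d}. of_bool (i \<in> T) * real (\<tau> i))"
      unfolding inner
    proof (rule sum_mono)
      fix i assume i: "i \<in> {1..d}"
      then show "level t w $ idx i * y $ idx i \<le> of_bool (i \<in> T) * real (\<tau> i)"
        using \<delta>[OF i] t by (auto simp: level_def step_def y T_def)
    qed
    also have "\<dots> \<le> (\<Sum>i\<in>{1..d}. of_bool (i \<in> T) * real (\<sigma> i))"
      unfolding abs of_nat_le_iff
      by (rule permutation_sum_le_upper_set[OF \<sigma> \<tau>]) (use \<rho>(2) in \<open>auto simp: T_def \<sigma>_def\<close>)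
    also have "\<dots> = level t w \<bullet> x"
      unfolding inner using t by (intro sum.cong) (auto simp: level_def step_def x T_def \<epsilon>_def)
    finally show "level t w \<bullet> y \<le> level t w \<bullet> x" .
  qed
qed

text \<open>All levels of \<open>w\<close> lie in one normal cone of the permutahedron. Coarsening
  puts that cone inside a normal cone of \<open>P\<close>, and any point of the corresponding face
  of \<open>P\<close> maximizes all levels.\<close>

lemma type_B_linear_gen_permutahedron_B:
  fixes idx :: "nat \<Rightarrow> 'n::finite"
  assumes idx: "bij_betw idx {1..d} UNIV" and P: "gen_permutahedron_B d idx P"
  shows "type_B_linear P"
  unfolding type_B_linear_def
proof
  fix w :: "real ^ 'n"
  let ?\<Pi> = "permutahedron_B d idx"
  obtain v where v: "v \<in> ?\<Pi>" "\<And>t q. t > 0 \<Longrightarrow> q \<in> ?\<Pi> \<Longrightarrow> level t w \<bullet> q \<le> level t w \<bullet> v"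
    using type_B_linear_permutahedron_B[OF idx] unfolding type_B_linear_def by blast
  \<comment> \<open>The face on which all levels are maximal simultaneously; the common maximizer
    \<open>v\<close> shows that it is nonempty.\<close>
  define F where "F = (\<Inter>t\<in>{0<..}. ?\<Pi> \<inter> {x. level t w \<bullet> x = level t w \<bullet> v})"
  have "F face_of ?\<Pi>"
    unfolding F_def
  proof (rule face_of_Inter)
    fix T assume "T \<in> (\<lambda>t. ?\<Pi> \<inter> {x. level t w \<bullet> x = level t w \<bullet> v}) ` {0<..}"
    then obtain t where t: "0 < t" "T = ?\<Pi> \<inter> {x. level t w \<bullet> x = level t w \<bullet> v}" by auto
    show "T face_of ?\<Pi>"
      unfolding t(2)
      by (rule face_of_Int_supporting_hyperplane_le)
        (use t(1) v(2) in \<open>auto simp: permutahedron_B_def\<close>)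
  qed auto
  moreover have "v \<in> F" using v(1) by (auto simp: F_def)
  ultimately have "normal_cone ?\<Pi> F \<in> normal_fan ?\<Pi>"
    unfolding normal_fan_def by blast
  then obtain D where "D \<in> normal_fan P" "normal_cone ?\<Pi> F \<subseteq> D"
    using P unfolding gen_permutahedron_B_def fan_coarsens_def by blast
  then obtain G where G: "G face_of P" "G \<noteq> {}" "normal_cone ?\<Pi> F \<subseteq> normal_cone P G"
    unfolding normal_fan_def by blast
  have "level t w \<in> normal_cone ?\<Pi> F" if "0 < t" for t
    using that v(2) by (auto simp: normal_cone_def F_def)
  then have cone: "level t w \<in> normal_cone P G" if "0 < t" for t
    using that G(3) by blast
  obtain g where "g \<in> G" using G(2) by blast
  moreover have "g \<in> P" using face_of_imp_subset[OF G(1)] \<open>g \<in> G\<close> by blast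
  ultimately show "\<exists>v\<in>P. \<forall>t>0. \<forall>q\<in>P. level t w \<bullet> q \<le> level t w \<bullet> v"
    using cone unfolding normal_cone_def by blast
qed

section \<open>Values on the rays\<close>

definition ray :: "(nat \<Rightarrow> 'n::finite) \<Rightarrow> int set \<Rightarrow> real ^ 'n" where
  "ray idx T = (\<Sum>i\<in>T. signed_unit idx i)"

lemma signed_unit_inner_signed_unit:
  assumes idx: "inj_on idx {1..d}" and "i \<in> signed_indices d" "k \<in> signed_indices d"
  shows "signed_unit idx k \<bullet> signed_unit idx i = of_bool (k = i) - of_bool (k = - i)"
proof -
  have mem: "nat \<bar>i\<bar> \<in> {1..d}" "nat \<bar>k\<bar> \<in> {1..d}" and nz: "i \<noteq> 0" "k \<noteq> 0"
    using assms(2,3) by (auto simp: signed_indices_def)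
  have "idx (nat \<bar>k\<bar>) = idx (nat \<bar>i\<bar>) \<longleftrightarrow> \<bar>k\<bar> = \<bar>i\<bar>"
    using inj_on_eq_iff[OF idx mem(2,1)] by auto
  then show ?thesis
    using nz unfolding inner_signed_unit by (auto simp: signed_unit_def axis_def abs_if sgn_if split: if_splits)
qed

lemma ray_inner_signed_unit:
  assumes idx: "inj_on idx {1..d}" and T: "involution_exclusive d T" and i: "i \<in> signed_indices d"
  shows "ray idx T \<bullet> signed_unit idx i = of_bool (i \<in> T) - of_bool (- i \<in> T)"
proof -
  have fin: "finite T" using T by (rule involution_exclusive_finite)
  have "ray idx T \<bullet> signed_unit idx i = (\<Sum>k\<in>T. of_bool (k = i) - of_bool (k = - i))"
    unfolding ray_def inner_sum_left
    by (rule sum.cong[OF refl], rule signed_unit_inner_signed_unit[OF idx i])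
      (use T in \<open>auto simp: involution_exclusive_def\<close>)
  then show ?thesis using fin by (simp add: sum_subtractf of_bool_def)
qed

text \<open>\<open>T\<close> collects the signed indices at which \<open>w\<close> is at least
  \<open>t\<close>; as \<open>t > 0\<close>, no index occurs with its negative. \<open>T\<close> is
  empty when \<open>t\<close> exceeds all absolute values, and then the vector is 0.\<close>

lemma level_eq_ray:
  fixes idx :: "nat \<Rightarrow> 'n::finite"
  assumes idx: "bij_betw idx {1..d} UNIV" and t: "0 < t"
  obtains T where "involution_exclusive d T" "level t w = ray idx T"
proof -
  have inj: "inj_on idx {1..d}" using idx by (rule bij_betw_imp_inj_on)
  define T where "T = {i\<in>signed_indices d. t \<le> w \<bullet> signed_unit idx i}"
  have uminus: "w \<bullet> signed_unit idx (- i) = - (w \<bullet> signed_unit idx i)" for i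
    by (simp add: inner_signed_unit)
  have T: "involution_exclusive d T"
    unfolding involution_exclusive_def using t by (auto simp: T_def uminus)
  have "level t w $ j = ray idx T $ j" for j
  proof -
    obtain k where k: "k \<in> {1..d}" "idx k = j" using idx by (metis UNIV_I bij_betw_def imageE)
    have coord: "u $ j = u \<bullet> signed_unit idx (int k)" for u :: "real ^ 'n"
      using k by (simp add: inner_signed_unit)
    have "int k \<in> signed_indices d" "- int k \<in> signed_indices d"
      using k by (auto simp: signed_indices_def)
    then show ?thesis
      unfolding coord level_inner_signed_unit[OF t] using t
      by (subst ray_inner_signed_unit[OF inj T]) (auto simp: T_def uminus step_def)
  qed
  then have "level t w = ray idx T" by (simp add: vec_eq_iff)
  then show ?thesis using that T by blast
qed

lemma support_function_Simplex_ray: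
  assumes idx: "inj_on idx {1..d}" and S: "S \<in> exclusive_sets d" and T: "involution_exclusive d T"
  shows "support_function (Simplex idx S) (ray idx T) =
      of_bool (S \<inter> T \<noteq> {}) - of_bool (uminus ` S \<subseteq> T)"
    and "support_function (Simplex0 idx S) (ray idx T) = of_bool (S \<inter> T \<noteq> {})"
proof -
  have inner: "ray idx T \<bullet> signed_unit idx i = of_bool (i \<in> T) - of_bool (- i \<in> T)" if "i \<in> S" for i
    using that S by (intro ray_inner_signed_unit[OF idx T]) (auto simp: involution_exclusive_def)
  have excl: "- i \<notin> T" if "i \<in> T" for i
    using T that by (force simp: involution_exclusive_def)
  obtain i0 where i0: "i0 \<in> S" using S by blast
  \<comment> \<open>On the vertices the functional takes values 1, 0 and -1; the cases correspond to
    maximum 1, -1 and 0.\<close>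
  consider i where "i \<in> S" "i \<in> T" | "S \<inter> T = {}" "uminus ` S \<subseteq> T"
    | i where "S \<inter> T = {}" "i \<in> S" "- i \<notin> T" by blast
  then show "support_function (Simplex idx S) (ray idx T) =
      of_bool (S \<inter> T \<noteq> {}) - of_bool (uminus ` S \<subseteq> T)"
  proof cases
    case 1
    then have "support_function (Simplex idx S) (ray idx T) = ray idx T \<bullet> signed_unit idx i"
      unfolding Simplex_def by (intro support_function_hull) (auto simp: inner excl)
    then show ?thesis using 1 excl by (auto simp: inner)
  next
    case 2
    then have in_T: "i \<notin> T \<and> - i \<in> T" if "i \<in> S" for i using that by blast
    then have "support_function (Simplex idx S) (ray idx T) = ray idx T \<bullet> signed_unit idx i0"
      unfolding Simplex_def using i0 by (intro support_function_hull) (auto simp: inner)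
    then show ?thesis using 2 i0 in_T by (auto simp: inner)
  next
    case 3
    then have "support_function (Simplex idx S) (ray idx T) = ray idx T \<bullet> signed_unit idx i"
      unfolding Simplex_def by (intro support_function_hull) (auto simp: inner)
    then show ?thesis using 3 by (auto simp: inner)
  qed
  show "support_function (Simplex0 idx S) (ray idx T) = of_bool (S \<inter> T \<noteq> {})"
  proof (cases "S \<inter> T = {}")
    case True
    then have "support_function (Simplex0 idx S) (ray idx T) = ray idx T \<bullet> 0"
      unfolding Simplex0_def by (intro support_function_hull) (auto simp: inner)
    then show ?thesis using True by simp
  next
    case False
    then obtain i where i: "i \<in> S" "i \<in> T" by blast
    then have "support_function (Simplex0 idx S) (ray idx T) = ray idx T \<bullet> signed_unit idx i"
      unfolding Simplex0_def by (intro support_function_hull) (auto simp: inner excl)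
    then show ?thesis using i excl by (auto simp: inner)
  qed
qed

section \<open>Distinctness of the simplices\<close>

text \<open>Either simplex recovers \<open>S\<close> as the set of \<open>i\<close> at which its
  support function is 1 on the ray of \<open>{i}\<close>. On the ray of \<open>-S\<close> the
  support function is -1 for \<open>Simplex idx S\<close> but nonnegative for every
  \<open>Simplex0\<close>, which separates the two families.\<close>

lemma Simplex_inject:
  assumes idx: "inj_on idx {1..d}" and S: "S \<in> exclusive_sets d" "S' \<in> exclusive_sets d"
  shows "Simplex idx S = Simplex idx S' \<Longrightarrow> S = S'"
    and "Simplex0 idx S = Simplex0 idx S' \<Longrightarrow> S = S'"
    and "Simplex idx S \<noteq> Simplex0 idx S'"
proof -
  have single: "involution_exclusive d {i}" if "i \<in> signed_indices d" for i
    using that by (auto simp: involution_exclusive_def signed_indices_def)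
  have mem: "i \<in> S \<longleftrightarrow> i \<in> signed_indices d \<and> support_function (Simplex idx S) (ray idx {i}) = 1"
    "i \<in> S \<longleftrightarrow> i \<in> signed_indices d \<and> support_function (Simplex0 idx S) (ray idx {i}) = 1"
    if "S \<in> exclusive_sets d" for S i
  proof -
    \<comment> \<open>Otherwise \<open>- i = i\<close>, so \<open>i = 0\<close>, which is not a
      signed index.\<close>
    have "\<not> uminus ` S \<subseteq> {i}" if "i \<in> S"
      using \<open>S \<in> exclusive_sets d\<close> that by (auto simp: involution_exclusive_def signed_indices_def)
    then have val: "(of_bool (S \<inter> {i} \<noteq> {}) - of_bool (uminus ` S \<subseteq> {i}) = (1 :: real)) \<longleftrightarrow> i \<in> S"
      "(of_bool (S \<inter> {i} \<noteq> {}) = (1 :: real)) \<longleftrightarrow> i \<in> S"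
      by (cases "i \<in> S"; cases "uminus ` S \<subseteq> {i}"; simp)+
    have sub: "i \<in> S \<Longrightarrow> i \<in> signed_indices d"
      using that by (auto simp: involution_exclusive_def)
    show "i \<in> S \<longleftrightarrow> i \<in> signed_indices d \<and> support_function (Simplex idx S) (ray idx {i}) = 1"
      "i \<in> S \<longleftrightarrow> i \<in> signed_indices d \<and> support_function (Simplex0 idx S) (ray idx {i}) = 1"
      using val sub support_function_Simplex_ray[OF idx that single, of i] by metis+
  qed
  show "Simplex idx S = Simplex idx S' \<Longrightarrow> S = S'"
    using mem(1)[OF S(1)] mem(1)[OF S(2)] by auto
  show "Simplex0 idx S = Simplex0 idx S' \<Longrightarrow> S = S'"
    using mem(2)[OF S(1)] mem(2)[OF S(2)] by auto
  show "Simplex idx S \<noteq> Simplex0 idx S'"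
  proof
    assume eq: "Simplex idx S = Simplex0 idx S'"
    have excl: "involution_exclusive d (uminus ` S)" "S \<inter> uminus ` S = {}"
      using S(1) involution_exclusive_uminus[of d S] by (simp_all add: involution_exclusive_def)
    have "support_function (Simplex idx S) (ray idx (uminus ` S)) = -1"
      using support_function_Simplex_ray(1)[OF idx S(1) excl(1)] excl(2) by simp
    moreover have "support_function (Simplex0 idx S') (ray idx (uminus ` S)) \<ge> 0"
      using support_function_Simplex_ray(2)[OF idx S(2) excl(1)] by simp
    ultimately show False using eq by simp
  qed
qed

lemma inj_on_Simplex:
  assumes "inj_on idx {1..d}"
  shows "inj_on (Simplex idx) {S. special d S}" "inj_on (Simplex0 idx) {S. special d S}"
proof -
  have exclusive: "S \<in> exclusive_sets d" if "S \<in> {S. special d S}" for S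
    using that special_exclusive by simp
  show "inj_on (Simplex idx) {S. special d S}" "inj_on (Simplex0 idx) {S. special d S}"
    by (rule inj_onI, rule Simplex_inject[OF assms exclusive exclusive], assumption+)+
qed

lemma finite_special_simplices: "finite (special_simplices d idx)"
  by (simp add: special_simplices_def finite_special)

text \<open>The families are disjoint and injectively indexed, so coefficients on simplices amount
  to pairs of coefficients on special sets.\<close>

lemma sum_special_simplices:
  assumes idx: "inj_on idx {1..d}"
  shows "(\<Sum>Q\<in>special_simplices d idx. g Q) =
    (\<Sum>S | special d S. g (Simplex idx S) + (g (Simplex0 idx S) :: real))"
proof -
  note inj = inj_on_Simplex[OF idx]
  have "Simplex idx ` {S. special d S} \<inter> Simplex0 idx ` {S. special d S} = {}"
    using Simplex_inject(3)[OF idx special_exclusive special_exclusive] by auto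
  then show ?thesis
    unfolding special_simplices_def using inj
    by (subst sum.union_disjoint) (auto simp: finite_special sum.reindex sum.distrib)
qed

section \<open>Reduction to the rays and solution of the system\<close>

text \<open>All support functions involved are linear on the type B cones, so their identity need
  only be tested on rays. There it becomes the combinatorial system with
  \<open>c S = y (Simplex idx S) + y (Simplex0 idx S)\<close> and
  \<open>e S = - y (Simplex idx S)\<close>.\<close>

lemma signed_Minkowski_sum_special_iff:
  fixes idx :: "nat \<Rightarrow> 'n::finite"
  assumes idx: "bij_betw idx {1..d} UNIV" and P: "gen_permutahedron_B d idx P"
  shows "signed_Minkowski_sum P (special_simplices d idx) y \<longleftrightarrow>
    (\<forall>T\<in>exclusive_sets d.
      (\<Sum>S | special d S. (y (Simplex idx S) + y (Simplex0 idx S)) * of_bool (S \<inter> T \<noteq> {}) +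
        - y (Simplex idx S) * of_bool (uminus ` S \<subseteq> T)) = support_function P (ray idx T))"
    (is "_ \<longleftrightarrow> (\<forall>T\<in>_. ?comb T = _)")
proof -
  let ?Q = "special_simplices d idx"
  have inj: "inj_on idx {1..d}" using idx by (rule bij_betw_imp_inj_on)
  have body: "convex_body P"
    using P polytope_imp_compact polytope_imp_convex by (auto simp: gen_permutahedron_B_def convex_body_def)
  have comb: "(\<Sum>Q\<in>?Q. y Q * support_function Q (ray idx T)) = ?comb T"
    if "involution_exclusive d T" for T
    unfolding sum_special_simplices[OF inj]
    by (rule sum.cong[OF refl])
      (simp add: support_function_Simplex_ray[OF inj special_exclusive that] algebra_simps)
  have "(\<forall>w. support_function P w = (\<Sum>Q\<in>?Q. y Q * support_function Q w)) \<longleftrightarrow>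
    (\<forall>T\<in>exclusive_sets d. ?comb T = support_function P (ray idx T))"
  proof
    assume "\<forall>w. support_function P w = (\<Sum>Q\<in>?Q. y Q * support_function Q w)"
    then show "\<forall>T\<in>exclusive_sets d. ?comb T = support_function P (ray idx T)"
      using comb by simp
  next
    assume rays: "\<forall>T\<in>exclusive_sets d. ?comb T = support_function P (ray idx T)"
    have rays': "support_function P (ray idx T) = (\<Sum>Q\<in>?Q. y Q * support_function Q (ray idx T))"
      if T: "involution_exclusive d T" for T
    \<comment> \<open>A level can be the zero vector, where every support function vanishes.\<close>
    proof (cases "T = {}")
      case True
      have "support_function Q 0 = 0" if "convex_body Q" for Q :: "(real ^ 'n) set"
        using that by (simp add: support_function_def convex_body_def)
      then show ?thesis
        using True body convex_body_special_simplices[of _ d idx] by (simp add: ray_def)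
    next
      case False
      then show ?thesis using rays comb[OF T] T by simp
    qed
    have lin: "type_B_linear Q" if "Q \<in> ?Q" for Q
      using that involution_exclusive_finite[of d]
      unfolding special_simplices_def special_def by (auto intro!: type_B_linear_Simplex)
    show "\<forall>w. support_function P w = (\<Sum>Q\<in>?Q. y Q * support_function Q w)"
    proof
      fix w :: "real ^ 'n"
      obtain L l where L: "\<And>t. t \<in> L \<Longrightarrow> 0 < t"
        and sf: "\<And>Q. type_B_linear Q \<Longrightarrow> support_function Q w = (\<Sum>t\<in>L. l t * support_function Q (level t w))"
        using support_function_layers[of w] by metis
      have lev: "support_function P (level t w) = (\<Sum>Q\<in>?Q. y Q * support_function Q (level t w))"
        if t: "t \<in> L" for t
        using level_eq_ray[OF idx L[OF t], of w] rays' by metis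
      have "support_function P w = (\<Sum>t\<in>L. \<Sum>Q\<in>?Q. y Q * (l t * support_function Q (level t w)))"
        unfolding sf[OF type_B_linear_gen_permutahedron_B[OF idx P]]
        by (rule sum.cong[OF refl]) (simp add: lev sum_distrib_left mult.left_commute)
      also have "\<dots> = (\<Sum>Q\<in>?Q. \<Sum>t\<in>L. y Q * (l t * support_function Q (level t w)))"
        by (rule sum.swap)
      also have "\<dots> = (\<Sum>Q\<in>?Q. y Q * support_function Q w)"
        by (rule sum.cong[OF refl]) (simp add: sf[OF lin] sum_distrib_left)
      finally show "support_function P w = (\<Sum>Q\<in>?Q. y Q * support_function Q w)" .
    qed
  qed
  then show ?thesis
    using signed_Minkowski_sum_iff[OF finite_special_simplices convex_body_special_simplices body] by simp
qed

theorem theoremt: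
  fixes d :: nat and idx :: "nat \<Rightarrow> 'n::finite" and P :: "(real ^ 'n) set"
  assumes "bij_betw idx {1..d} UNIV"
    and "gen_permutahedron_B d idx P"
  shows "\<exists>!y. y \<in> extensional (special_simplices d idx) \<and>
              signed_Minkowski_sum P (special_simplices d idx) y"
proof -
  let ?Q = "special_simplices d idx"
  have idx: "inj_on idx {1..d}" using assms(1) by (rule bij_betw_imp_inj_on)
  note iff = signed_Minkowski_sum_special_iff[OF assms]
  obtain c e where ce: "\<And>T. T \<in> exclusive_sets d \<Longrightarrow>
      (\<Sum>S | special d S. c S * of_bool (S \<inter> T \<noteq> {}) + e S * of_bool (uminus ` S \<subseteq> T)) =
      support_function P (ray idx T)"
    using special_coefficients_exist[of d "\<lambda>T. support_function P (ray idx T)"] by blast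
  \<comment> \<open>Inverts the substitution: the coefficient of \<open>Simplex idx S\<close> is
    \<open>- e S\<close> and that of \<open>Simplex0 idx S\<close> is
    \<open>c S + e S\<close>.\<close>
  define y where "y = restrict (\<lambda>Q. if Q \<in> Simplex idx ` {S. special d S}
      then - e (inv_into {S. special d S} (Simplex idx) Q)
      else c (inv_into {S. special d S} (Simplex0 idx) Q) + e (inv_into {S. special d S} (Simplex0 idx) Q)) ?Q"
  note inj = inj_on_Simplex[OF idx]
  have y: "y (Simplex idx S) = - e S" "y (Simplex0 idx S) = c S + e S" if "special d S" for S
  proof -
    have "Simplex0 idx S \<notin> Simplex idx ` {S. special d S}"
      using Simplex_inject(3)[OF idx special_exclusive special_exclusive[OF that]] by auto
    then show "y (Simplex idx S) = - e S" "y (Simplex0 idx S) = c S + e S"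
      using that inv_into_f_f[OF inj(1), of S] inv_into_f_f[OF inj(2), of S]
      by (auto simp: y_def special_simplices_def)
  qed
  show ?thesis
  proof (rule ex1I, intro conjI)
    show "y \<in> extensional ?Q" by (simp add: y_def)
    show "signed_Minkowski_sum P ?Q y"
      unfolding iff
    proof
      fix T assume T: "T \<in> exclusive_sets d"
      show "(\<Sum>S | special d S. (y (Simplex idx S) + y (Simplex0 idx S)) * of_bool (S \<inter> T \<noteq> {}) +
        - y (Simplex idx S) * of_bool (uminus ` S \<subseteq> T)) = support_function P (ray idx T)"
        unfolding ce[OF T, symmetric] by (rule sum.cong[OF refl]) (simp add: y)
    qed
  next
    fix z assume z: "z \<in> extensional ?Q \<and> signed_Minkowski_sum P ?Q z"
    \<comment> \<open>The differences between the system coefficients of \<open>z\<close> and those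
      of \<open>y\<close>; they solve the homogeneous system.\<close>
    define c' e' where "c' S = z (Simplex idx S) + z (Simplex0 idx S) - c S"
      and "e' S = - z (Simplex idx S) - e S" for S
    have zero: "(\<Sum>S | special d S. c' S * of_bool (S \<inter> T \<noteq> {}) + e' S * of_bool (uminus ` S \<subseteq> T)) = 0"
      if T: "T \<in> exclusive_sets d" for T
    proof -
      have "(\<Sum>S | special d S. (z (Simplex idx S) + z (Simplex0 idx S)) * of_bool (S \<inter> T \<noteq> {}) +
          - z (Simplex idx S) * of_bool (uminus ` S \<subseteq> T)) =
        (\<Sum>S | special d S. c S * of_bool (S \<inter> T \<noteq> {}) + e S * of_bool (uminus ` S \<subseteq> T))"
        using z T unfolding iff ce[OF T] by blast
      then show ?thesis
        unfolding c'_def e'_def by (simp add: left_diff_distrib sum.distrib sum_subtractf sum_negf)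
    qed
    have "z (Simplex idx S) = y (Simplex idx S)" "z (Simplex0 idx S) = y (Simplex0 idx S)"
      if "special d S" for S
      using special_coefficients_unique[OF zero that] y[OF that] by (simp_all add: c'_def e'_def)
    then have "z Q = y Q" if "Q \<in> ?Q" for Q
      using that by (auto simp: special_simplices_def)
    then show "z = y"
      using z by (intro extensionalityI[of _ ?Q]) (auto simp: y_def)
  qed
qed

end
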